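(* Let $P$ be a probability law (the calibration transition law) on a measurable space $\mathcal{T}$ of transitions, and let $Q_{\mathcal{A}}$ be a probability law on $\mathcal{T}$ (the transition law induced by an improvement operator $\mathcal{A}$) with $Q_{\mathcal{A}}\ll P$ and $\chi^2(Q_{\mathcal{A}}\Vert P)<\infty$. Let $w=dQ_{\mathcal{A}}/dP$, and let $\ell(\tau)=L(\Delta_V(\tau),\Delta_*(\tau))$ be a real-valued measurable function of $\tau\in\mathcal{T}$ with finite variance under $P$. Then $$\left|\mathbb{E}_{Q_{\mathcal{A}}}[\ell]-\mathbb{E}_P[\ell]\right|\leq\sqrt{\operatorname{Var}_P(\ell)\,\chi^2(Q_{\mathcal{A}}\Vert P)}.$$
   Context: A transition is a proposed replacement $\tau=(\pi,\pi')$ of an incumbent policy $\pi$ by a candidate policy $\pi'$. $\Delta_V(\tau)=J_V(\pi')-J_V(\pi)$ is the improvement estimated by a verifier with value function $J_V$, and $\Delta_*(\tau)=J(\pi';\mathcal{M}[\pi'])-J(\pi;\mathcal{M}[\pi])$ is the deployment improvement, where $J(\pi;\mathcal{M}[\pi])\in\mathbb{R}$ is the value of $\pi$ in the deployment world $\mathcal{M}[\pi]$ it induces. $L:\mathbb{R}\times\mathbb{R}\to\mathbb{R}$ is a transition-level loss; no property of $L$, $\Delta_V$, $\Delta_*$ is used beyond $\ell$ being a measurable real function on $\mathcal{T}$ with finite variance under $P$ (i.e. $\mathbb{E}_P[\ell^2]<\infty$). The chi-square divergence is $\chi^2(Q\Vert P)=\mathbb{E}_P[(dQ/dP-1)^2]$.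 *)

theory Defs
  imports "HOL-Probability.Probability"
begin

text \<open>A transition is a pair of an incumbent policy and a candidate policy.
  A policy \<open>p\<close> induces the deployment world \<open>world p\<close>, and \<open>J p m\<close> is the
  value of policy \<open>p\<close> in world \<open>m\<close>.\<close>

type_synonym 'p transition = "'p \<times> 'p"

definition verifier_improvement :: "('p \<Rightarrow> real) \<Rightarrow> 'p transition \<Rightarrow> real" where
  "verifier_improvement J\<^sub>V = (\<lambda>(p, p'). J\<^sub>V p' - J\<^sub>V p)"

definition deployment_improvement ::
    "('p \<Rightarrow> 'm \<Rightarrow> real) \<Rightarrow> ('p \<Rightarrow> 'm) \<Rightarrow> 'p transition \<Rightarrow> real" where
  "deployment_improvement J world = (\<lambda>(p, p'). J p' (world p') - J p (world p))"

definition transition_loss ::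
    "(real \<Rightarrow> real \<Rightarrow> real) \<Rightarrow> ('p \<Rightarrow> real) \<Rightarrow> ('p \<Rightarrow> 'm \<Rightarrow> real) \<Rightarrow> ('p \<Rightarrow> 'm)
      \<Rightarrow> 'p transition \<Rightarrow> real" where
  "transition_loss L J\<^sub>V J world \<tau> =
     L (verifier_improvement J\<^sub>V \<tau>) (deployment_improvement J world \<tau>)"

text \<open>The real-valued density \<open>dQ/dP\<close>. It is meaningful only when \<open>Q\<close> is absolutely
  continuous with respect to \<open>P\<close>; the library's density is finite almost everywhere
  when \<open>Q\<close> is a finite measure.\<close>

definition likelihood_ratio :: "'a measure \<Rightarrow> 'a measure \<Rightarrow> 'a \<Rightarrow> real" where
  "likelihood_ratio Q P x = enn2real (RN_deriv P Q x)"

text \<open>The value is an extended nonnegative real, so that finiteness of the divergence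
  is a genuine condition (a Bochner integral would be 0 in the divergent case).\<close>

definition chi_square_divergence :: "'a measure \<Rightarrow> 'a measure \<Rightarrow> ennreal" where
  "chi_square_divergence Q P = (\<integral>\<^sup>+ x. ennreal ((likelihood_ratio Q P x - 1)\<^sup>2) \<partial>P)"

end

theory Submission
  imports Defs
begin

text \<open>Since \<open>w\<close> has mean 1 under \<open>P\<close>, the difference of the two expectations of \<open>\<l>\<close> is the
  covariance \<open>E\<^sub>P[(w - 1) (\<l> - E\<^sub>P[\<l>])]\<close>, to which the Cauchy--Schwarz inequality applies.\<close>

text \<open>Domination: \<open>2 * \<bar>f x\<bar> * \<bar>g x\<bar>\<close> is at most the sum of
  the squares, and dropping the factor 2 only weakens the bound.\<close>

lemma square_integrable_imp_integrable_mult: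
  fixes f g :: "'a \<Rightarrow> real"
  assumes [measurable]: "f \<in> borel_measurable M" "g \<in> borel_measurable M"
    and "integrable M (\<lambda>x. (f x)\<^sup>2)" "integrable M (\<lambda>x. (g x)\<^sup>2)"
  shows "integrable M (\<lambda>x. f x * g x)"
proof (rule Bochner_Integration.integrable_bound)
  show "integrable M (\<lambda>x. (f x)\<^sup>2 + (g x)\<^sup>2)"
    using assms by simp
  have "\<bar>f x * g x\<bar> \<le> (f x)\<^sup>2 + (g x)\<^sup>2" for x
    using sum_squares_bound[of "\<bar>f x\<bar>" "\<bar>g x\<bar>"] abs_ge_zero[of "f x * g x"]
    unfolding abs_mult power2_abs by linarith
  then show "AE x in M. norm (f x * g x) \<le> norm ((f x)\<^sup>2 + (g x)\<^sup>2)"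
    by simp
qed simp

lemma Cauchy_Schwarz_lebesgue_integral:
  fixes f g :: "'a \<Rightarrow> real"
  assumes meas [measurable]: "f \<in> borel_measurable M" "g \<in> borel_measurable M"
    and sq: "integrable M (\<lambda>x. (f x)\<^sup>2)" "integrable M (\<lambda>x. (g x)\<^sup>2)"
  shows "\<bar>\<integral>x. f x * g x \<partial>M\<bar> \<le> sqrt ((\<integral>x. (f x)\<^sup>2 \<partial>M) * (\<integral>x. (g x)\<^sup>2 \<partial>M))"
proof -
  have int: "integrable M (\<lambda>x. \<bar>f x\<bar> * \<bar>g x\<bar>)"
    using square_integrable_imp_integrable_mult[OF meas sq]
    by (simp add: integrable_abs flip: abs_mult)
  \<comment> \<open>The inequality is taken from its form for nonnegative integrals. Absolute values
    make the integrand nonnegative, and \<open>int\<close> makes its integral finite, so both sides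
    can be brought back to the reals.\<close>
  have "ennreal ((\<integral>x. \<bar>f x\<bar> * \<bar>g x\<bar> \<partial>M)\<^sup>2)
      = (\<integral>\<^sup>+x. ennreal \<bar>f x\<bar> * ennreal \<bar>g x\<bar> \<partial>M)\<^sup>2"
    using int by (simp add: nn_integral_eq_integral ennreal_power flip: ennreal_mult)
  also have "\<dots> \<le> (\<integral>\<^sup>+x. (ennreal \<bar>f x\<bar>)\<^sup>2 \<partial>M) * (\<integral>\<^sup>+x. (ennreal \<bar>g x\<bar>)\<^sup>2 \<partial>M)"
    by (rule Cauchy_Schwarz_nn_integral) simp_all
  also have "\<dots> = ennreal ((\<integral>x. (f x)\<^sup>2 \<partial>M) * (\<integral>x. (g x)\<^sup>2 \<partial>M))"
    using sq by (simp add: nn_integral_eq_integral ennreal_power ennreal_mult)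
  finally have "(\<integral>x. \<bar>f x\<bar> * \<bar>g x\<bar> \<partial>M)\<^sup>2 \<le> (\<integral>x. (f x)\<^sup>2 \<partial>M) * (\<integral>x. (g x)\<^sup>2 \<partial>M)"
    by (simp add: ennreal_le_iff)
  then have "(\<integral>x. \<bar>f x\<bar> * \<bar>g x\<bar> \<partial>M) \<le> sqrt ((\<integral>x. (f x)\<^sup>2 \<partial>M) * (\<integral>x. (g x)\<^sup>2 \<partial>M))"
    by (rule real_le_rsqrt)
  moreover have "\<bar>\<integral>x. f x * g x \<partial>M\<bar> \<le> (\<integral>x. \<bar>f x\<bar> * \<bar>g x\<bar> \<partial>M)"
    using integral_abs_bound[of M "\<lambda>x. f x * g x"] by (simp add: abs_mult)
  ultimately show ?thesis
    by linarith
qed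

text \<open>Integrability under \<open>Q\<close> is part of the conclusion because a Bochner
  integral defaults to 0 otherwise, and the bound would then say nothing about a genuine
  expectation.\<close>

lemma chi_square_expectation_bound:
  fixes f :: "'a \<Rightarrow> real"
  assumes "prob_space P" "prob_space Q"
    and sets: "sets Q = sets P" and ac: "absolutely_continuous P Q"
    and chi: "chi_square_divergence Q P < \<infinity>"
    and f [measurable]: "f \<in> borel_measurable P"
    and f2: "integrable P (\<lambda>x. (f x)\<^sup>2)"
  shows "integrable Q f"
    and "\<bar>prob_space.expectation Q f - prob_space.expectation P f\<bar>
      \<le> sqrt (prob_space.variance P f * enn2real (chi_square_divergence Q P))"
proof -
  interpret P: prob_space P by fact
  interpret Q: prob_space Q by fact
  define w where "w = likelihood_ratio Q P"
  define c where "c = P.expectation f"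
  have w [measurable]: "w \<in> borel_measurable P"
    unfolding w_def likelihood_ratio_def by measurable
  have Q_int: "integrable Q g \<longleftrightarrow> integrable P (\<lambda>x. w x * g x)"
    and Q_exp: "Q.expectation g = P.expectation (\<lambda>x. w x * g x)"
    if "g \<in> borel_measurable P" for g :: "'a \<Rightarrow> real"
    unfolding w_def likelihood_ratio_def
    using P.RN_deriv_integrable[OF Q.sigma_finite_measure_axioms ac sets that]
      P.RN_deriv_integral[OF Q.sigma_finite_measure_axioms ac sets that]
    by simp_all
  have chi_eq: "chi_square_divergence Q P = (\<integral>\<^sup>+x. ennreal ((w x - 1)\<^sup>2) \<partial>P)"
    by (simp add: chi_square_divergence_def w_def)
  \<comment> \<open>Here the finiteness of the divergence enters.\<close>
  have w2: "integrable P (\<lambda>x. (w x - 1)\<^sup>2)"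
    using chi by (intro integrableI_nonneg) (simp_all add: chi_eq)
  have f_int: "integrable P f"
    by (rule P.square_integrable_imp_integrable[OF f f2])
  \<comment> \<open>Change of measure for the constant function 1, using that \<open>Q\<close> has
    total mass 1.\<close>
  have w_int: "integrable P w" and w_exp: "P.expectation w = 1"
    using Q_int[of "\<lambda>_. 1"] Q_exp[of "\<lambda>_. 1"] Q.prob_space by simp_all
  \<comment> \<open>Square integrability is at hand for \<open>w - 1\<close> rather than for
    \<open>w\<close>, so the product is split as \<open>w * f = (w - 1) * f + f\<close>.\<close>
  have wf: "integrable P (\<lambda>x. (w x - 1) * f x)"
    using w2 f2 by (intro square_integrable_imp_integrable_mult) simp_all
  then have wf': "integrable P (\<lambda>x. w x * f x)"
    using Bochner_Integration.integrable_add[OF wf f_int] by (simp add: algebra_simps)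
  then show "integrable Q f"
    by (simp add: Q_int)
  have fc2: "integrable P (\<lambda>x. (f x - c)\<^sup>2)"
    using f_int f2 by (simp add: power2_diff)
  \<comment> \<open>Under \<open>P\<close> the last two terms cancel, since \<open>w\<close> has
    mean 1. Centring \<open>f\<close> at its mean thus leaves the difference of expectations
    unchanged, while turning the second moment in the bound into the variance.\<close>
  have "(\<lambda>x. (w x - 1) * (f x - c)) = (\<lambda>x. w x * f x - f x - c * w x + c)"
    by (simp add: algebra_simps)
  then have "P.expectation (\<lambda>x. (w x - 1) * (f x - c)) = Q.expectation f - P.expectation f"
    using wf' f_int w_int by (simp add: Q_exp w_exp P.prob_space)
  moreover have "P.expectation (\<lambda>x. (w x - 1)\<^sup>2) = enn2real (chi_square_divergence Q P)"
    unfolding chi_eq by (rule integral_eq_nn_integral) simp_all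
  ultimately show "\<bar>Q.expectation f - P.expectation f\<bar>
      \<le> sqrt (P.variance f * enn2real (chi_square_divergence Q P))"
    using Cauchy_Schwarz_lebesgue_integral[OF _ _ w2 fc2]
    by (simp add: c_def mult.commute)
qed

theorem proposition3:
  fixes P Q\<^sub>A :: "'p transition measure"
    and L :: "real \<Rightarrow> real \<Rightarrow> real"
    and J\<^sub>V :: "'p \<Rightarrow> real"
    and J :: "'p \<Rightarrow> 'm \<Rightarrow> real"
    and world :: "'p \<Rightarrow> 'm"
    and \<l> :: "'p transition \<Rightarrow> real"
  defines "\<l> \<equiv> transition_loss L J\<^sub>V J world"
  assumes "prob_space P"
    and "prob_space Q\<^sub>A"
    and "sets Q\<^sub>A = sets P"
    and "absolutely_continuous P Q\<^sub>A"
    and "chi_square_divergence Q\<^sub>A P < \<infinity>"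
    and "\<l> \<in> borel_measurable P"
    and "integrable P (\<lambda>\<tau>. (\<l> \<tau>)\<^sup>2)"
  shows "integrable Q\<^sub>A \<l> \<and>
    \<bar>prob_space.expectation Q\<^sub>A \<l> - prob_space.expectation P \<l>\<bar>
      \<le> sqrt (prob_space.variance P \<l> * enn2real (chi_square_divergence Q\<^sub>A P))"
  using assms by (blast intro: chi_square_expectation_bound)

end
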